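(* Let $n\ge 1$ be a natural number and let $\rho\in\mathbf{W}_n$. Let $X=\{t_j\}_{j=1}^m$ be a finite set of points with $$-1<t_1<t_2<\dots<t_m<1,$$ such that $X\cap[x_n,1]\neq\emptyset$ and $$S_k\left(X\cap[x_{k+1},1]\right)=X\cap[x_k,x_{k+1}]\quad\text{for all }k=0,1,2,\dots,n-1.$$ Then for every polynomial $P$ of degree at most $2^n-1$, $$\int_{-1}^1P(x)\rho(x)\,dx=\frac1m\sum_{k=1}^mP(t_k).$$
   Context: Sequence $x_n$: $x_0=-1$ and $x_{n+1}=\sqrt{\frac{1+x_n}{2}}$ for $n=0,1,2,\dots$ (so $x_1=0$; the sequence is increasing with limit $1$). Polynomials $P_{2^p}$: $P_1(x)=x$, $P_2(x)=2x^2-1$, and $P_{2^p}(x)=P_2(P_{2^{p-1}}(x))$ for $p\ge 1$. On $[x_p,1]$ the polynomial $P_{2^p}$ is increasing, with $P_{2^p}(x_p)=-1$, $P_{2^p}(x_{p+1})=0$, $P_{2^p}(1)=1$. Maps $S_n$: $S_0:[x_1,1]\to[x_0,x_1]$ is $S_0(x)=-x$. For $n\ge1$, $S_n:[x_{n+1},1]\to[x_n,x_{n+1}]$ is the one-to-one mapping such that $P_{2^n}(x)=-P_{2^n}(S_n(x))$ for $x_{n+1}\le x\le 1$. Class $\mathbf{W}_n$ ($n\ge1$): the family of nonnegative (measurable) functions $\rho$ on $(-1,1)$ such that $\int_{-1}^1\rho(x)\,dx=1$ and, for each $k=0,1,\dots,n-1$, $$\rho(y)=-\rho(S_k(y))\,\frac{dS_k(y)}{dy}\quad\text{for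 all } x_{k+1}<y<1.$$ *)

theory Defs
  imports "HOL-Analysis.Analysis" "HOL-Computational_Algebra.Polynomial"
begin

fun xseq :: "nat \<Rightarrow> real" where
  "xseq 0 = -1"
| "xseq (Suc n) = sqrt ((1 + xseq n) / 2)"

(* The index is the exponent: P2pow p is the polynomial P_(2^p). *)
fun P2pow :: "nat \<Rightarrow> real poly" where
  "P2pow 0 = [:0, 1:]"
| "P2pow (Suc p) = pcompose [:-1, 0, 2:] (P2pow p)"

(* S_n is meaningful only on [x_(n+1), 1]; elsewhere the value is irrelevant.  That the
   description below is proper on this interval is shown in S_map_ex1. *)
definition S_map :: "nat \<Rightarrow> real \<Rightarrow> real" where
  "S_map n x =
     (if n = 0 then - x
      else (THE y. y \<in> {xseq n..xseq (Suc n)} \<and> poly (P2pow n) x = - poly (P2pow n) y))"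

(* The Lebesgue integral of a non-integrable function is 0 by convention, so that the
   normalisation to 1 also says that rho is integrable on (-1, 1). *)
definition W_class :: "nat \<Rightarrow> (real \<Rightarrow> real) set" where
  "W_class n = {\<rho>.
     set_borel_measurable lebesgue {-1<..<1} \<rho> \<and>
     (\<forall>x\<in>{-1<..<1}. 0 \<le> \<rho> x) \<and>
     (LINT x:{-1<..<1}|lebesgue. \<rho> x) = 1 \<and>
     (\<forall>k<n. \<forall>y\<in>{xseq (Suc k)<..<1}. \<rho> y = - \<rho> (S_map k y) * deriv (S_map k) y)}"

lemma xseq_eq_cos: "xseq n = cos (pi / 2 ^ n)"
proof (induction n)
  case (Suc n)
  have "pi / 2 ^ Suc n \<le> pi / 2" "0 \<le> pi / 2 ^ Suc n"
    by (auto simp: field_simps)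
  then have "0 \<le> cos (pi / 2 ^ Suc n)"
    using pi_gt_zero by (intro cos_ge_zero) linarith+
  moreover have "cos (pi / 2 ^ n) = 2 * (cos (pi / 2 ^ Suc n))\<^sup>2 - 1"
    using cos_double_cos[of "pi / 2 ^ Suc n"] by (simp add: field_simps)
  ultimately show ?case using Suc by simp
qed simp

lemma poly_P2pow_cos: "poly (P2pow n) (cos t) = cos (2 ^ n * t)"
proof (induction n)
  case (Suc n)
  then show ?case
    using cos_double_cos[of "2 ^ n * t"]
    by (simp add: poly_pcompose power2_eq_square algebra_simps)
qed simp

lemma P2pow_strict_mono: "strict_mono_on {xseq n..1} (poly (P2pow n))"
proof (rule strict_mono_onI)
  fix a b assume ab: "a \<in> {xseq n..1}" "b \<in> {xseq n..1}" "a < b"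
  have lo: "-1 \<le> xseq n" by (simp add: xseq_eq_cos)
  have A: "a = cos (arccos a)" "b = cos (arccos b)" using ab lo by auto
  have "arccos b < arccos a" using ab lo by (intro arccos_less_arccos) auto
  moreover have "arccos a \<le> pi / 2 ^ n"
  proof -
    have "arccos a \<le> arccos (xseq n)" using ab lo by (intro arccos_le_arccos) auto
    also have "arccos (xseq n) = pi / 2 ^ n"
      unfolding xseq_eq_cos by (rule arccos_cos) (auto simp: field_simps)
    finally show ?thesis .
  qed
  moreover have "0 \<le> arccos b" using ab lo by (intro arccos_lbound) auto
  ultimately have "cos (2 ^ n * arccos a) < cos (2 ^ n * arccos b)"
    by (intro cos_monotone_0_pi) (auto simp: field_simps)
  then show "poly (P2pow n) a < poly (P2pow n) b"
    using A poly_P2pow_cos by metis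
qed

lemma S_map_cos_aux:
  assumes "x \<in> {xseq (Suc n)..1}"
  defines "y \<equiv> cos (pi / 2 ^ n - arccos x)"
  shows "y \<in> {xseq n..xseq (Suc n)}" "poly (P2pow n) x = - poly (P2pow n) y"
proof -
  have lo: "-1 \<le> xseq (Suc n)" unfolding xseq_eq_cos by simp
  have "arccos x \<le> arccos (xseq (Suc n))" using assms(1) lo by (intro arccos_le_arccos) auto
  also have "arccos (xseq (Suc n)) = pi / 2 ^ Suc n"
    unfolding xseq_eq_cos
    using one_le_power[of "2::real" "Suc n"] by (intro arccos_cos) (auto simp: field_simps)
  finally have t: "arccos x \<le> pi / 2 ^ Suc n" .
  have t0: "0 \<le> arccos x" using assms(1) lo by (intro arccos_lbound) auto
  have h: "pi / 2 ^ n \<le> pi" "pi / 2 ^ n = 2 * (pi / 2 ^ Suc n)" by (auto simp: field_simps)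
  have p: "0 < pi / 2 ^ Suc n" by simp
  have "cos (pi / 2 ^ n) \<le> y" "y \<le> cos (pi / 2 ^ Suc n)"
    unfolding y_def by (rule cos_monotone_0_pi_le; use t t0 h p in linarith)+
  then show "y \<in> {xseq n..xseq (Suc n)}" unfolding xseq_eq_cos by simp
  have "x = cos (arccos x)" using assms(1) lo by auto
  then have "poly (P2pow n) x = cos (2 ^ n * arccos x)" using poly_P2pow_cos by metis
  moreover have "poly (P2pow n) y = cos (pi - 2 ^ n * arccos x)"
    unfolding y_def poly_P2pow_cos by (simp add: algebra_simps)
  ultimately show "poly (P2pow n) x = - poly (P2pow n) y" by simp
qed

lemma S_map_ex1:
  assumes "x \<in> {xseq (Suc n)..1}"
  shows "\<exists>!y. y \<in> {xseq n..xseq (Suc n)} \<and> poly (P2pow n) x = - poly (P2pow n) y"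
proof (rule ex_ex1I)
  show "\<exists>y. y \<in> {xseq n..xseq (Suc n)} \<and> poly (P2pow n) x = - poly (P2pow n) y"
    using S_map_cos_aux[OF assms] by blast
next
  fix y z
  assume "y \<in> {xseq n..xseq (Suc n)} \<and> poly (P2pow n) x = - poly (P2pow n) y"
    and "z \<in> {xseq n..xseq (Suc n)} \<and> poly (P2pow n) x = - poly (P2pow n) z"
  moreover have "xseq (Suc n) \<le> 1" unfolding xseq_eq_cos by simp
  ultimately have "y \<in> {xseq n..1}" "z \<in> {xseq n..1}" "poly (P2pow n) y = poly (P2pow n) z"
    by (auto simp del: xseq.simps)
  then show "y = z"
    using strict_mono_on_imp_inj_on[OF P2pow_strict_mono[of n]] by (auto dest: inj_onD)
qed

lemma S_map_eq_cos:
  assumes "x \<in> {xseq (Suc n)..1}"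
  shows "S_map n x = cos (pi / 2 ^ n - arccos x)"
proof (cases n)
  case 0
  have "-1 \<le> x" "x \<le> 1" using assms 0 by auto
  then show ?thesis by (simp add: 0 S_map_def)
next
  case (Suc k)
  then show ?thesis
    using the1_equality[OF S_map_ex1[OF assms]] S_map_cos_aux[OF assms]
    by (simp add: S_map_def del: xseq.simps P2pow.simps)
qed

(* Hence the derivative in W_class is a genuine one. *)
lemma S_map_differentiable:
  assumes "x \<in> {xseq (Suc n)<..<1}"
  shows "S_map n differentiable (at x)"
proof -
  have lo: "-1 \<le> xseq (Suc n)" unfolding xseq_eq_cos by simp
  have "((\<lambda>x. cos (pi / 2 ^ n - arccos x)) has_real_derivative
      - sin (pi / 2 ^ n - arccos x) * (0 - inverse (- sqrt (1 - x\<^sup>2)))) (at x)"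
    using assms lo by (auto intro!: derivative_eq_intros)
  then have "(S_map n has_real_derivative
      - sin (pi / 2 ^ n - arccos x) * (0 - inverse (- sqrt (1 - x\<^sup>2)))) (at x)"
    by (rule has_field_derivative_transform_within_open[where S = "{xseq (Suc n)<..<1}"])
       (use assms S_map_eq_cos in auto)
  then show ?thesis by (auto simp: real_differentiable_def)
qed

end

theory Submission
  imports Defs
begin

text \<open>With \<open>x = cos \<theta>\<close> the map \<open>S\<^sub>k\<close> is the reflection \<open>\<theta> \<mapsto> \<pi>/2\<^sup>k - \<theta>\<close> of
  \<open>[0, \<pi>/2\<^sup>k]\<close>, so a Chebyshev polynomial \<open>T\<^sub>j\<close> with \<open>2\<^sup>k\<close> dividing \<open>j\<close> satisfies
  \<open>T\<^sub>j \<circ> S\<^sub>k = \<plusminus> T\<^sub>j\<close>, the sign being negative iff \<open>j/2\<^sup>k\<close> is odd.  Both the integral against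
  \<open>\<rho>\<close> and the sum over \<open>X\<close> are invariant under \<open>S\<^sub>k\<close>.  For \<open>1 \<le> j < 2\<^sup>n\<close> write
  \<open>j = 2\<^sup>k i\<close> with \<open>i\<close> odd: then both functionals of \<open>T\<^sub>j\<close> vanish on \<open>[x\<^sub>k, 1]\<close>, and they double
  on passing from \<open>[x\<^sub>l\<^sub>+\<^sub>1, 1]\<close> to \<open>[x\<^sub>l, 1]\<close> for \<open>l < k\<close>, hence vanish on \<open>[-1, 1]\<close>.
  For the sum this needs that the fixed point \<open>x\<^sub>l\<^sub>+\<^sub>1\<close> of \<open>S\<^sub>l\<close> is not in \<open>X\<close>, which holds for
  \<open>l + 1 < n\<close> because it is the image of \<open>1 \<notin> X\<close> under the next reflection.\<close>

section \<open>Chebyshev polynomials of the first kind and expansion in them\<close>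

fun cheb :: "nat \<Rightarrow> real poly" where
  "cheb 0 = 1"
| "cheb (Suc 0) = [:0, 1:]"
| "cheb (Suc (Suc j)) = [:0, 2:] * cheb (Suc j) - cheb j"

lemma poly_cheb_cos: "poly (cheb j) (cos \<theta>) = cos (real j * \<theta>)"
proof (induction j rule: cheb.induct)
  case (3 j)
  have "cos (real (Suc (Suc j)) * \<theta>) + cos (real j * \<theta>) = 2 * cos \<theta> * cos (real (Suc j) * \<theta>)"
    using cos_add[of "real (Suc j) * \<theta>" \<theta>] cos_diff[of "real (Suc j) * \<theta>" \<theta>]
    by (simp add: algebra_simps)
  with 3 show ?case by simp
qed auto

text \<open>Both parts together make the degree exactly \<open>j\<close>; the recurrence doubles the
  leading coefficient from \<open>j = 1\<close> on, and only its being nonzero matters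
  below.\<close>

lemma cheb_degree_coeff: "degree (cheb j) \<le> j \<and> coeff (cheb j) j > 0"
proof (induction j rule: cheb.induct)
  case (3 j)
  have "degree ([:0, 2:] * cheb (Suc j)) \<le> 1 + degree (cheb (Suc j))"
    by (rule order.trans[OF degree_mult_le]) simp
  then have "degree (cheb (Suc (Suc j))) \<le> Suc (Suc j)"
    using 3 by (auto intro!: degree_diff_le)
  moreover have "coeff (cheb j) (Suc (Suc j)) = 0"
    using 3 by (intro coeff_eq_0) linarith
  then have "coeff (cheb (Suc (Suc j))) (Suc (Suc j)) = 2 * coeff (cheb (Suc j)) (Suc j)"
    by simp
  ultimately show ?case using 3 by simp
qed auto

text \<open>The first \<open>N\<close> Chebyshev polynomials have degrees 0 to \<open>N - 1\<close>,
  so they span the polynomials of degree below \<open>N\<close>. As an induction rule this fits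
  identities linear in \<open>P\<close>.\<close>

lemma poly_cheb_induct [consumes 1, case_names zero add_smult]:
  fixes P :: "real poly"
  assumes "degree P < N"
    and zero: "Q 0"
    and step: "\<And>P c j. j < N \<Longrightarrow> Q P \<Longrightarrow> Q (P + smult c (cheb j))"
  shows "Q P"
proof -
  \<comment> \<open>Bounding the support by \<open>d\<close> instead of the degree makes
    \<open>d = 0\<close> exactly the zero polynomial.\<close>
  have "Q P" if "\<forall>i\<ge>d. coeff P i = 0" "d \<le> N" for d P
    using that
  proof (induction d arbitrary: P)
    case 0
    then have "P = 0" by (intro poly_eqI) simp
    then show ?case using zero by simp
  next
    case (Suc d)
    \<comment> \<open>This multiple of \<open>cheb d\<close> cancels the top coefficient of
      \<open>P\<close>.\<close>
    define c where "c = coeff P d / coeff (cheb d) d"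
    have "coeff (P - smult c (cheb d)) i = 0" if "i \<ge> d" for i
    proof (cases "i = d")
      case True
      then show ?thesis using cheb_degree_coeff[of d] by (simp add: c_def)
    next
      case False
      then have "coeff (cheb d) i = 0"
        using that cheb_degree_coeff[of d] by (intro coeff_eq_0) linarith
      then show ?thesis using Suc.prems False that by simp
    qed
    then have "Q (P - smult c (cheb d))" using Suc by simp
    from step[OF _ this, of d c] show ?case using Suc.prems by simp
  qed
  moreover have "\<forall>i\<ge>N. coeff P i = 0" using assms(1) by (auto intro: coeff_eq_0)
  ultimately show ?thesis by blast
qed

section \<open>The points \<open>xseq k\<close> and the reflections \<open>S_map k\<close> in the
  angle variable\<close>

declare xseq.simps [simp del]

lemma xseq_strict: "xseq k < xseq (Suc k)" "xseq k < 1" "- 1 \<le> xseq k"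
proof -
  have "cos (pi / 2 ^ k) < cos (pi / 2 ^ Suc k)" for k
    by (rule cos_monotone_0_pi) (auto simp: field_simps)
  then show "xseq k < xseq (Suc k)" unfolding xseq_eq_cos .
  have "cos (pi / 2 ^ k) < cos 0"
    by (rule cos_monotone_0_pi) (auto simp: field_simps)
  then show "xseq k < 1" unfolding xseq_eq_cos by simp
qed (simp add: xseq_eq_cos)

lemma arccos_less_iff_xseq:
  assumes "- 1 \<le> x" "x \<le> 1"
  shows "arccos x < pi / 2 ^ k \<longleftrightarrow> xseq k < x" "arccos x = pi / 2 ^ k \<longleftrightarrow> xseq k = x"
proof -
  have a: "arccos (xseq k) = pi / 2 ^ k"
    unfolding xseq_eq_cos by (rule arccos_cos) (auto simp: field_simps)
  show "arccos x < pi / 2 ^ k \<longleftrightarrow> xseq k < x"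
    unfolding a[symmetric] using assms xseq_strict[of k] by (intro arccos_less_mono) auto
  show "arccos x = pi / 2 ^ k \<longleftrightarrow> xseq k = x"
    unfolding a[symmetric] using assms xseq_strict[of k] by (subst arccos_eq_iff) auto
qed

lemma arccos_S_map:
  assumes "x \<in> {xseq (Suc k)..1}"
  shows "arccos (S_map k x) = pi / 2 ^ k - arccos x"
proof -
  have x: "- 1 \<le> x" "x \<le> 1" using assms xseq_strict[of "Suc k"] by auto
  then have "arccos x \<le> pi / 2 ^ Suc k"
    using assms arccos_less_iff_xseq[OF x, of "Suc k"] by auto
  also have "\<dots> \<le> pi / 2 ^ k" by (auto simp: field_simps)
  finally have "arccos x \<le> pi / 2 ^ k" .
  moreover have "pi / 2 ^ k \<le> pi" by (auto simp: field_simps)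
  moreover have "0 \<le> arccos x" using x by (rule arccos_lbound)
  ultimately show ?thesis
    unfolding S_map_eq_cos[OF assms] by (intro arccos_cos) auto
qed

lemma S_map_inj_on: "inj_on (S_map k) {xseq (Suc k)..1}"
proof (rule inj_onI)
  fix x y assume *: "x \<in> {xseq (Suc k)..1}" "y \<in> {xseq (Suc k)..1}" "S_map k x = S_map k y"
  then have "arccos x = arccos y" using arccos_S_map[of x k] arccos_S_map[of y k] by simp
  moreover have "- 1 \<le> x" "x \<le> 1" "- 1 \<le> y" "y \<le> 1" using * xseq_strict[of "Suc k"] by auto
  ultimately show "x = y" by (subst (asm) arccos_eq_iff) auto
qed

lemma S_map_fixed: "S_map k (xseq (Suc k)) = xseq (Suc k)"
proof -
  have "arccos (xseq (Suc k)) = pi / 2 ^ Suc k"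
    using xseq_strict[of "Suc k"] by (subst arccos_less_iff_xseq) auto
  then have "pi / 2 ^ k - arccos (xseq (Suc k)) = pi / 2 ^ Suc k" by (simp add: field_simps)
  moreover have "xseq (Suc k) \<in> {xseq (Suc k)..1}" using xseq_strict[of "Suc k"] by auto
  ultimately show ?thesis using S_map_eq_cos by (metis xseq_eq_cos)
qed

text \<open>The point \<open>xseq k\<close> has angle \<open>pi / 2 ^ k\<close>, which is the
  reflection of the angle 0. This later keeps \<open>xseq k\<close> out of \<open>X\<close>.\<close>

lemma S_map_eq_xseq:
  assumes "x \<in> {xseq (Suc k)..1}" "S_map k x = xseq k"
  shows "x = 1"
proof -
  have "arccos (xseq k) = pi / 2 ^ k"
    using xseq_strict[of k] by (subst arccos_less_iff_xseq) auto
  then have "arccos x = 0" using arccos_S_map[OF assms(1)] assms(2) by simp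
  moreover have "- 1 \<le> x" "x \<le> 1" using assms xseq_strict[of "Suc k"] by auto
  ultimately show "x = 1" by (metis cos_arccos cos_zero)
qed

lemma S_map_image: "S_map k ` {xseq (Suc k)<..<1} = {xseq k<..<xseq (Suc k)}"
proof (intro equalityI subsetI)
  fix y assume "y \<in> S_map k ` {xseq (Suc k)<..<1}"
  then obtain x where x: "x \<in> {xseq (Suc k)<..<1}" "y = S_map k x" by auto
  then have x': "x \<in> {xseq (Suc k)..1}" by simp
  have fix': "xseq (Suc k) \<in> {xseq (Suc k)..1}" using xseq_strict[of "Suc k"] by auto
  have "y \<in> {xseq k..xseq (Suc k)}"
    using S_map_cos_aux(1)[OF x'] S_map_eq_cos[OF x'] x by simp
  moreover have "y \<noteq> xseq k" using S_map_eq_xseq[OF x'] x by auto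
  moreover have "y \<noteq> xseq (Suc k)"
    using inj_onD[OF S_map_inj_on _ x' fix'] S_map_fixed[of k] x by auto
  ultimately show "y \<in> {xseq k<..<xseq (Suc k)}" by auto
next
  fix y assume y: "y \<in> {xseq k<..<xseq (Suc k)}"
  then have y': "- 1 \<le> y" "y \<le> 1" using xseq_strict[of k] xseq_strict[of "Suc k"] by auto
  \<comment> \<open>The reflection is an involution on angles, so reflecting the angle of
    \<open>y\<close> gives the angle of its preimage.\<close>
  define \<theta> where "\<theta> = pi / 2 ^ k - arccos y"
  have "pi / 2 ^ Suc k < arccos y" "arccos y < pi / 2 ^ k"
    using y arccos_less_iff_xseq[OF y', of k] arccos_less_iff_xseq[OF y', of "Suc k"] by auto
  then have \<theta>: "0 < \<theta>" "\<theta> < pi / 2 ^ Suc k" unfolding \<theta>_def by (auto simp: field_simps)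
  have "pi / 2 ^ Suc k \<le> pi" using one_le_power[of "2::real" "Suc k"] by (auto simp: field_simps)
  with \<theta> have \<theta>': "\<theta> \<le> pi" by simp
  have "cos \<theta> < cos 0" using \<theta> \<theta>' by (intro cos_monotone_0_pi) auto
  moreover have ac: "arccos (cos \<theta>) = \<theta>" using \<theta> \<theta>' by (intro arccos_cos) auto
  then have "xseq (Suc k) < cos \<theta>"
    using \<theta> arccos_less_iff_xseq(1)[of "cos \<theta>" "Suc k"] by simp
  ultimately have in': "cos \<theta> \<in> {xseq (Suc k)<..<1}" by simp
  then have "S_map k (cos \<theta>) = cos (pi / 2 ^ k - \<theta>)"
    by (subst S_map_eq_cos) (auto simp: ac)
  also have "\<dots> = y" using y' by (simp add: \<theta>_def)
  finally have "S_map k (cos \<theta>) = y" .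
  then show "y \<in> S_map k ` {xseq (Suc k)<..<1}" using in' by blast
qed

text \<open>The derivative is \<open>- sin (arccos (S_map k x)) / sqrt (1 - x^2)\<close>, and sine
  is nonnegative on angles in [0, pi]. The sign identifies the Jacobian with the factor in
  \<open>W_class\<close>.\<close>

lemma deriv_S_map_nonpos:
  assumes "x \<in> {xseq (Suc k)<..<1}"
  shows "deriv (S_map k) x \<le> 0"
proof -
  have x: "- 1 \<le> x" "x \<le> 1" "- 1 < x" using assms xseq_strict[of "Suc k"] by auto
  have "((\<lambda>x. cos (pi / 2 ^ k - arccos x)) has_real_derivative
      - sin (pi / 2 ^ k - arccos x) * (0 - inverse (- sqrt (1 - x\<^sup>2)))) (at x)"
    using assms x by (auto intro!: derivative_eq_intros)
  then have "(S_map k has_real_derivative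
      - sin (pi / 2 ^ k - arccos x) * (0 - inverse (- sqrt (1 - x\<^sup>2)))) (at x)"
    by (rule has_field_derivative_transform_within_open[where S = "{xseq (Suc k)<..<1}"])
       (use assms S_map_eq_cos in auto)
  then have "deriv (S_map k) x = - sin (arccos (S_map k x)) * inverse (sqrt (1 - x\<^sup>2))"
    using DERIV_imp_deriv assms by (subst arccos_S_map) fastforce+
  moreover have "S_map k x \<in> {xseq k<..<xseq (Suc k)}" using assms S_map_image by blast
  then have "0 \<le> sin (arccos (S_map k x))"
    using xseq_strict[of k] xseq_strict[of "Suc k"]
    by (intro sin_ge_zero arccos_lbound arccos_ubound) auto
  moreover have "x\<^sup>2 \<le> 1" using x by (simp add: abs_square_le_1)
  ultimately show ?thesis by simp
qed

section \<open>Chebyshev polynomials, integrals and sums under one reflection\<close>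

lemma poly_cheb_S_map:
  assumes "x \<in> {xseq (Suc k)..1}"
  shows "poly (cheb (2 ^ k * i)) (S_map k x) = (- 1) ^ i * poly (cheb (2 ^ k * i)) x"
proof -
  have x: "- 1 \<le> x" "x \<le> 1" using assms xseq_strict[of "Suc k"] by auto
  define \<phi> where "\<phi> = real (2 ^ k * i) * arccos x"
  \<comment> \<open>Multiplying the angle by \<open>2 ^ k * i\<close> turns
    \<open>pi / 2 ^ k\<close> into \<open>i * pi\<close>.\<close>
  have "poly (cheb (2 ^ k * i)) (S_map k x) = cos (real i * pi - \<phi>)"
    unfolding S_map_eq_cos[OF assms] poly_cheb_cos \<phi>_def by (simp add: right_diff_distrib)
  also have "\<dots> = (- 1) ^ i * cos \<phi>" by (simp add: cos_diff mult.commute[of _ pi])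
  also have "cos \<phi> = poly (cheb (2 ^ k * i)) x"
    using poly_cheb_cos[of "2 ^ k * i" "arccos x"] x by (simp add: \<phi>_def)
  finally show ?thesis .
qed

text \<open>Substituting \<open>S_map k\<close> carries the integral over the left piece to the
  right piece; the \<open>W_class\<close> condition absorbs the Jacobian into \<rho>, leaving the
  factor \<open>s\<close>.\<close>

lemma integral_reflect:
  fixes \<rho> f :: "real \<Rightarrow> real"
  assumes \<rho>: "\<rho> \<in> W_class n" and k: "k < n"
    and h: "(\<lambda>x. f x * \<rho> x) absolutely_integrable_on {-1<..<1}"
    and f: "\<And>x. x \<in> {xseq (Suc k)..1} \<Longrightarrow> f (S_map k x) = s * f x"
  shows "integral {xseq k..1} (\<lambda>x. f x * \<rho> x)
           = (1 + s) * integral {xseq (Suc k)..1} (\<lambda>x. f x * \<rho> x)"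
proof -
  let ?h = "\<lambda>x. f x * \<rho> x" and ?A = "{xseq (Suc k)<..<1}"
  have "(S_map k has_field_derivative deriv (S_map k) y) (at y within ?A)" if "y \<in> ?A" for y
    using S_map_differentiable[OF that]
    by (metis has_field_derivative_at_within DERIV_deriv_iff_real_differentiable)
  moreover have "inj_on (S_map k) ?A"
    by (rule inj_on_subset[OF S_map_inj_on]) auto
  moreover have "?h absolutely_integrable_on S_map k ` ?A"
    using h unfolding S_map_image
    by (rule set_integrable_subset)
       (use xseq_strict[of k] xseq_strict[of "Suc k"] in auto)
  ultimately have "integral ?A (\<lambda>y. \<bar>deriv (S_map k) y\<bar> * ?h (S_map k y))
      = integral {xseq k<..<xseq (Suc k)} ?h"
    using has_absolute_integral_change_of_variables_1'[of ?A "S_map k" "deriv (S_map k)" ?h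
        "integral {xseq k<..<xseq (Suc k)} ?h"]
    by (simp add: S_map_image)
  moreover have "\<bar>deriv (S_map k) y\<bar> * ?h (S_map k y) = s * ?h y" if y: "y \<in> ?A" for y
  proof -
    have "\<rho> y = - \<rho> (S_map k y) * deriv (S_map k) y" using \<rho> k y by (auto simp: W_class_def)
    moreover have "f (S_map k y) = s * f y" using y by (intro f) auto
    ultimately show ?thesis using deriv_S_map_nonpos[OF y] by simp
  qed
  then have "integral ?A (\<lambda>y. \<bar>deriv (S_map k) y\<bar> * ?h (S_map k y)) = integral ?A (\<lambda>y. s * ?h y)"
    by (rule integral_cong)
  ultimately have "integral {xseq k<..<xseq (Suc k)} ?h = s * integral ?A ?h" by simp
  \<comment> \<open>Endpoints are null sets; closed intervals can be glued at
    \<open>xseq (Suc k)\<close>.\<close>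
  then have *: "integral {xseq k..xseq (Suc k)} ?h = s * integral {xseq (Suc k)..1} ?h"
    by (simp add: integral_open_interval_real)
  have "?h integrable_on {-1..1}"
    using set_lebesgue_integral_eq_integral(1)[OF h] by (simp add: integrable_on_open_interval_real)
  then have "?h integrable_on {xseq k..1}"
    by (rule integrable_on_subinterval) (use xseq_strict in auto)
  then have "integral {xseq k..1} ?h
      = integral {xseq k..xseq (Suc k)} ?h + integral {xseq (Suc k)..1} ?h"
    using xseq_strict[of k] xseq_strict[of "Suc k"]
    by (intro Henstock_Kurzweil_Integration.integral_combine[symmetric]) auto
  then show ?thesis using * by (simp add: algebra_simps)
qed

text \<open>The discrete counterpart: the fixed point \<open>xseq (Suc k)\<close> lies in both
  pieces and could be counted twice. Assumption \<open>s\<close> prevents this: for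
  \<open>s = - 1\<close> it forces \<open>f = - f = 0\<close> there, otherwise the point is not in
  \<open>X\<close>.\<close>

lemma sum_reflect:
  fixes f :: "real \<Rightarrow> real"
  assumes X: "finite X" "S_map k ` (X \<inter> {xseq (Suc k)..1}) = X \<inter> {xseq k..xseq (Suc k)}"
    and f: "\<And>x. x \<in> {xseq (Suc k)..1} \<Longrightarrow> f (S_map k x) = s * f x"
    and s: "s = - 1 \<or> xseq (Suc k) \<notin> X"
  shows "(\<Sum>x\<in>X \<inter> {xseq k..1}. f x) = (1 + s) * (\<Sum>x\<in>X \<inter> {xseq (Suc k)..1}. f x)"
proof -
  let ?A = "X \<inter> {xseq (Suc k)..1}" and ?B = "X \<inter> {xseq k..xseq (Suc k)}"
  have fixed: "f (xseq (Suc k)) = 0" if "s = - 1"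
    using f[of "xseq (Suc k)"] xseq_strict[of "Suc k"] that by (simp add: S_map_fixed)
  have "(\<Sum>x\<in>?B. f x) = (\<Sum>x\<in>?A. f (S_map k x))"
    unfolding X(2)[symmetric]
    by (subst sum.reindex) (auto intro: inj_on_subset[OF S_map_inj_on])
  also have "\<dots> = s * (\<Sum>x\<in>?A. f x)" by (simp add: f sum_distrib_left)
  finally have B: "(\<Sum>x\<in>?B. f x) = s * (\<Sum>x\<in>?A. f x)" .
  have "X \<inter> {xseq k..1} = ?B \<union> ?A"
    using xseq_strict[of k] xseq_strict[of "Suc k"] by auto
  moreover have "\<forall>x\<in>?B \<inter> ?A. f x = 0"
    using s fixed by (auto dest: antisym)
  ultimately have "(\<Sum>x\<in>X \<inter> {xseq k..1}. f x) = (\<Sum>x\<in>?B. f x) + (\<Sum>x\<in>?A. f x)"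
    using X(1) by (simp add: sum.union_inter_neutral)
  then show ?thesis using B by (simp add: algebra_simps)
qed

text \<open>Here \<open>a k\<close> stands for a functional restricted to
  \<open>{xseq k..1}\<close>. An even cofactor is allowed only for \<open>Suc k < n\<close>, since
  \<open>xseq n\<close> itself may belong to \<open>X\<close>.\<close>

lemma dyadic_recursion_zero:
  fixes a :: "nat \<Rightarrow> real"
  assumes j: "0 < j" "j < 2 ^ n"
    and step: "\<And>k i. k < n \<Longrightarrow> j = 2 ^ k * i \<Longrightarrow> odd i \<or> Suc k < n
      \<Longrightarrow> a k = (1 + (- 1) ^ i) * a (Suc k)"
  shows "a 0 = 0"
proof -
  obtain k i where ki: "j = 2 ^ k * i" "odd i"
    by (rule multiplicity_decompose'[of j "2::nat"]) (use j(1) in auto)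
  have "(2::nat) ^ k \<le> j" using ki odd_pos[of i] by simp
  then have "(2::nat) ^ k < 2 ^ n" using j(2) by (rule le_less_trans)
  then have k: "k < n" by (rule power_less_imp_less_exp[rotated]) simp
  have "a l = 0" if "l \<le> k" for l
    using that
  proof (induction rule: inc_induct)
    case base
    show ?case using step[OF k ki(1)] ki(2) by simp
  next
    case (step l)
    \<comment> \<open>For \<open>l < k\<close> the cofactor is even and
      \<open>Suc l \<le> k < n\<close>, so \<open>a l\<close> is twice
      \<open>a (Suc l)\<close>.\<close>
    have "j = 2 ^ l * (2 ^ (k - l) * i)"
      using step.hyps ki by (simp add: mult.assoc[symmetric] power_add[symmetric])
    then show ?case using assms(3)[of l "2 ^ (k - l) * i"] k step by simp
  qed
  then show ?thesis by simp
qed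

lemma continuous_mult_absolutely_integrable:
  fixes f g :: "real \<Rightarrow> real"
  assumes f: "continuous_on {a..b} f" and g: "g absolutely_integrable_on {a<..<b}"
  shows "(\<lambda>x. f x * g x) absolutely_integrable_on {a<..<b}"
proof (rule absolutely_integrable_bounded_measurable_product_real)
  have "continuous_on {a<..<b} f" by (rule continuous_on_subset[OF f]) auto
  then show "f \<in> borel_measurable (lebesgue_on {a<..<b})"
    by (intro continuous_imp_measurable_on_sets_lebesgue) auto
  have "bounded (f ` {a..b})"
    by (intro compact_imp_bounded compact_continuous_image f) simp
  then show "bounded (f ` {a<..<b})" by (rule bounded_subset) auto
qed (use g in auto)

theorem theorem4p2:
  fixes n m :: nat and \<rho> :: "real \<Rightarrow> real" and t :: "nat \<Rightarrow> real" and X :: "real set"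
  assumes "n \<ge> 1"
    and "\<rho> \<in> W_class n"
    and "X = t ` {1..m}"
    and "strict_mono_on {1..m} t"
    and "X \<subseteq> {-1<..<1}"
    and "X \<inter> {xseq n..1} \<noteq> {}"
    and "\<forall>k<n. S_map k ` (X \<inter> {xseq (Suc k)..1}) = X \<inter> {xseq k..xseq (Suc k)}"
  shows "\<forall>P :: real poly. degree P \<le> 2 ^ n - 1 \<longrightarrow>
           (LINT x:{-1<..<1}|lebesgue. poly P x * \<rho> x) = (1 / real m) * (\<Sum>k=1..m. poly P (t k))"
proof (intro allI impI)
  fix P :: "real poly"
  assume "degree P \<le> 2 ^ n - 1"
  then have deg: "degree P < 2 ^ n" by (simp add: Suc_le_eq[symmetric] le_diff_conv2)
  let ?I = "\<lambda>P. LINT x:{-1<..<1}|lebesgue. poly P x * \<rho> x"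
  let ?M = "\<lambda>P. (1 / real m) * (\<Sum>k=1..m. poly P (t k))"
  have m: "0 < m" using assms(3,6) by (cases m) auto
  have finX: "finite X" using assms(3) by simp
  have norm: "(LINT x:{-1<..<1}|lebesgue. \<rho> x) = 1" using assms(2) by (simp add: W_class_def)
  \<comment> \<open>The integral is 1, not the default 0 of a non-integrable function.\<close>
  then have "\<rho> absolutely_integrable_on {-1<..<1}"
    unfolding set_integrable_def set_lebesgue_integral_def
    using not_integrable_integral_eq by fastforce
  then have int: "(\<lambda>x. poly P x * \<rho> x) absolutely_integrable_on {-1<..<1}" for P
    by (intro continuous_mult_absolutely_integrable continuous_intros)
  have I_eq: "?I P = integral {xseq 0..1} (\<lambda>x. poly P x * \<rho> x)" for P
    using set_lebesgue_integral_eq_integral(2)[OF int[of P]]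
    by (simp add: integral_open_interval_real xseq.simps)
  have M_eq: "?M P = (\<Sum>x\<in>X \<inter> {xseq 0..1}. poly P x) / real m" for P
  proof -
    have "X \<inter> {xseq 0..1} = X" using assms(5) by (auto simp: xseq.simps)
    moreover have "inj_on t {1..m}" using assms(4) by (rule strict_mono_on_imp_inj_on)
    ultimately show ?thesis unfolding assms(3) by (simp add: sum.reindex)
  qed
  have notin: "xseq k \<notin> X" if "k < n" for k
  proof
    assume "xseq k \<in> X"
    then have "xseq k \<in> S_map k ` (X \<inter> {xseq (Suc k)..1})"
      using assms(7) that xseq_strict[of k] by auto
    then have "1 \<in> X" using S_map_eq_xseq by fastforce
    then show False using assms(5) by auto
  qed
  have zero: "?I (cheb j) = 0" "?M (cheb j) = 0" if j: "0 < j" "j < 2 ^ n" for j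
  proof -
    show "?I (cheb j) = 0"
      unfolding I_eq
      by (rule dyadic_recursion_zero[OF j,
            where a = "\<lambda>k. integral {xseq k..1} (\<lambda>x. poly (cheb j) x * \<rho> x)"])
         (rule integral_reflect[OF assms(2) _ int], use poly_cheb_S_map in auto)
    have "(\<Sum>x\<in>X \<inter> {xseq 0..1}. poly (cheb j) x) = 0"
      by (rule dyadic_recursion_zero[OF j,
            where a = "\<lambda>k. \<Sum>x\<in>X \<inter> {xseq k..1}. poly (cheb j) x"])
         (rule sum_reflect[OF finX], use poly_cheb_S_map notin assms(7) in auto)
    then show "?M (cheb j) = 0" unfolding M_eq by simp
  qed
  \<comment> \<open>For \<open>j = 0\<close> both sides are 1, by the normalisation of \<rho> and by
    \<open>m > 0\<close>.\<close>
  have cheb: "?I (cheb j) = ?M (cheb j)" if "j < 2 ^ n" for j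
    using zero[of j] that norm m by (cases "j = 0") auto
  from deg show "?I P = ?M P"
  proof (induction rule: poly_cheb_induct)
    case zero
    then show ?case by simp
  next
    case (add_smult P c j)
    have "?I (P + smult c (cheb j)) = ?I P + c * ?I (cheb j)"
      using set_integral_add(2)[OF int[of P] set_integrable_mult_right[OF int[of "cheb j"]], of c]
      by (simp add: distrib_right mult.assoc)
    also have "\<dots> = ?M P + c * ?M (cheb j)" using add_smult cheb by simp
    also have "\<dots> = ?M (P + smult c (cheb j))"
      by (simp add: sum.distrib sum_distrib_left add_divide_distrib sum_divide_distrib)
    finally show ?case .
  qed
qed

end
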